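(* Let $X$ be a real Banach space, let $f_n,f:X\to\mathbb{R}\cup\{+\infty\}$ ($n\in\mathbb{N}$) be lower semicontinuous functions, and let $x\in\operatorname{dom} f$. If $(f_n)_n$ is Wijsman convergent to $f$ at $x$, then there is a sequence $(x_n)_n\subset X$ such that $x_n\to x$, $f_n(x_n)\to f(x)$, and $$\limsup_n\,|\nabla f_n|(x_n)\le|\nabla f|(x).$$
   Context: $\operatorname{dom} f=\{x\in X: f(x)<\infty\}$ and $\operatorname{epi} f=\{(x,\alpha)\in X\times\mathbb{R}: f(x)\le\alpha\}$. $B_\lambda(x)$ is the closed ball of radius $\lambda$ centered at $x$ (with $B_0(x)=\{x\}$). $X\times\mathbb{R}$ carries the max norm $\|(x,t)\|=\max\{\|x\|,|t|\}$. For subsets $A,B$ of a normed space, the gap distance is $D(A,B)=\inf\{\|a-b\|: a\in A,\ b\in B\}$ (with $\inf\emptyset=+\infty$). Slope: for $x\in\operatorname{dom} f$, $$|\nabla f|(x):=\limsup_{y\to x,\ y\ne x}\frac{(f(x)-f(y))^+}{\|x-y\|},\qquad \alpha^+=\max(0,\alpha).$$ (When $f_n(x_n)\to f(x)<\infty$, one has $x_n\in\operatorname{dom} f_n$ for all large $n$, so $|\nabla f_n|(x_n)$ is defined for all large $n$; the limsup refers to these $n$.) Wijsman convergence at a point: $(f_n)_n$ is Wijsman convergent to $f$ at $x$ with radius $\lambda_x\in(0,+\infty]$ if for all $\lambda\in[0,\lambda_x)$ and all $\alpha\in\mathbb{R}$: (i) there is a sequence $x_n\to x$ in $X$ with $f_n(x_n)\to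 f(x)$; (ii) $D(B_\lambda(x)\times\{\alpha\},\operatorname{epi} f)>0$ implies $\sup_{\delta>0}\liminf_n D(B_{\lambda+\delta}(x)\times\{\alpha\},\operatorname{epi} f_n)>0$. It is Wijsman convergent to $f$ at $x$ if this holds for some radius $\lambda_x\in(0,+\infty]$. *)

theory Defs
  imports "HOL-Analysis.Analysis"
begin

definition lower_semicontinuous :: "('a::topological_space \<Rightarrow> ereal) \<Rightarrow> bool" where
  "lower_semicontinuous f \<longleftrightarrow> (\<forall>x. f x \<le> Liminf (at x) f)"

definition effective_domain :: "('a \<Rightarrow> ereal) \<Rightarrow> 'a set" where
  "effective_domain f = {x. f x < \<infinity>}"

definition epi :: "('a \<Rightarrow> ereal) \<Rightarrow> ('a \<times> real) set" where
  "epi f = {(x, \<alpha>). f x \<le> ereal \<alpha>}"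

text \<open>The library norm on a product type is the Euclidean one, so the max norm on
  \<open>X \<times> \<real>\<close> is a separate function, and the gap distance takes the norm as a parameter.\<close>

definition max_norm :: "'a::real_normed_vector \<times> real \<Rightarrow> real" where
  "max_norm p = max (norm (fst p)) \<bar>snd p\<bar>"

text \<open>The infimum is taken in \<^typ>\<open>ereal\<close>, so it is \<open>\<infinity>\<close> if one of the sets is empty
  (\<^const>\<open>setdist\<close> would be 0).\<close>

definition gap :: "('b::ab_group_add \<Rightarrow> real) \<Rightarrow> 'b set \<Rightarrow> 'b set \<Rightarrow> ereal" where
  "gap N A B = (INF a\<in>A. INF b\<in>B. ereal (N (a - b)))"

text \<open>Meaningful only for \<open>x\<close> in the effective domain of \<open>f\<close>, with \<open>f\<close> never \<open>-\<infinity>\<close>.  If the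
  space is trivial, \<^term>\<open>at x\<close> is the trivial filter and the value is \<open>-\<infinity>\<close>.\<close>

definition slope :: "('a::real_normed_vector \<Rightarrow> ereal) \<Rightarrow> 'a \<Rightarrow> ereal" where
  "slope f x = Limsup (at x) (\<lambda>y. max 0 (f x - f y) / ereal (norm (x - y)))"

definition wijsman_convergent_at_radius ::
  "(nat \<Rightarrow> 'a::real_normed_vector \<Rightarrow> ereal) \<Rightarrow> ('a \<Rightarrow> ereal) \<Rightarrow> 'a \<Rightarrow> ereal \<Rightarrow> bool" where
  "wijsman_convergent_at_radius fn f x r \<longleftrightarrow>
     (\<forall>l::real. \<forall>\<alpha>::real. 0 \<le> l \<and> ereal l < r \<longrightarrow>
        (\<exists>xs. xs \<longlonglongrightarrow> x \<and> (\<lambda>n. fn n (xs n)) \<longlonglongrightarrow> f x) \<and>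
        (gap max_norm (cball x l \<times> {\<alpha>}) (epi f) > 0 \<longrightarrow>
           (SUP \<delta>\<in>{0<..}. liminf (\<lambda>n. gap max_norm (cball x (l + \<delta>) \<times> {\<alpha>}) (epi (fn n)))) > 0))"

definition wijsman_convergent_at ::
  "(nat \<Rightarrow> 'a::real_normed_vector \<Rightarrow> ereal) \<Rightarrow> ('a \<Rightarrow> ereal) \<Rightarrow> 'a \<Rightarrow> bool" where
  "wijsman_convergent_at fn f x \<longleftrightarrow> (\<exists>r::ereal. 0 < r \<and> wijsman_convergent_at_radius fn f x r)"

end

theory Submission
  imports Defs
begin

text \<open>Suppose \<open>0 \<le> |\<nabla>f|(x) < c\<close> and fix a real \<open>c'\<close> with \<open>|\<nabla>f|(x) < c' < c\<close>.  Near \<open>x\<close>, the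
  function \<open>f\<close> lies above the downward cone \<open>f(x) - c' \<parallel>y - x\<parallel>\<close>.  On a ball of radius \<open>l\<close> this is a
  constant lower bound, that is, a gap between a flat disc and the epigraph; Wijsman convergence at
  \<open>x\<close> hands such a gap over to \<open>f\<^sub>n\<close> for large \<open>n\<close>.  Finitely many radii suffice to recover the whole
  cone up to an arbitrarily small error \<open>h\<close>
  (\<open>wijsman_eventually_linear_lower_bound\<close>).  So, for large \<open>n\<close>, the function
  \<open>f\<^sub>n + c' \<parallel>\<cdot> - x\<parallel>\<close> is at least \<open>f(x) - h\<close> on a fixed ball around \<open>x\<close>, whereas the recovery
  sequence of Wijsman convergence supplies points close to \<open>x\<close> with value close to \<open>f(x)\<close>, hence
  almost minimizers on that ball.

  Ekeland's principle with parameter \<open>c - c'\<close> moves such an almost minimizer by a distance of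
  order \<open>h / (c - c')\<close> to a point \<open>v\<close> at which the perturbed function decreases with rate at
  most \<open>c - c'\<close>.  For small \<open>h\<close> this \<open>v\<close> is interior to the ball, so removing the perturbation gives
  \<open>|\<nabla>f\<^sub>n|(v) \<le> c' + (c - c') = c\<close>; moreover \<open>v\<close> and \<open>f\<^sub>n(v)\<close> are as close to \<open>x\<close> and
  \<open>f(x)\<close> as desired (\<open>wijsman_eventually_point_of_small_slope\<close>).  A diagonal choice with
  \<open>c\<close> decreasing to \<open>|\<nabla>f|(x)\<close> yields the sequence.  If \<open>|\<nabla>f|(x) = \<infinity>\<close>, the recovery sequence
  itself will do, and it also does in the trivial space, where every slope is \<open>-\<infinity>\<close>.\<close>

section \<open>Lower semicontinuity and slope\<close>

lemma lower_semicontinuous_eventually_nhds: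
  fixes g :: "'a::topological_space \<Rightarrow> ereal"
  assumes "lower_semicontinuous g" and "a < g y"
  shows "\<forall>\<^sub>F w in nhds y. a < g w"
proof -
  have "a < Liminf (at y) g"
    using assms unfolding lower_semicontinuous_def by (meson less_le_trans)
  then have "\<forall>\<^sub>F w in at y. a < g w"
    by (rule less_LiminfD)
  with assms(2) show ?thesis
    by (simp add: eventually_nhds_conv_at)
qed

lemma closed_epi:
  fixes g :: "'a::metric_space \<Rightarrow> ereal"
  assumes "lower_semicontinuous g"
  shows "closed (epi g)"
  unfolding closed_sequential_limits
proof (intro allI impI, elim conjE)
  fix p :: "nat \<Rightarrow> 'a \<times> real" and l :: "'a \<times> real"
  assume p: "\<forall>n. p n \<in> epi g" and lim: "p \<longlonglongrightarrow> l"
  show "l \<in> epi g"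
  proof (rule ccontr)
    assume "l \<notin> epi g"
    then have "ereal (snd l) < g (fst l)"
      by (auto simp: epi_def case_prod_beta)
    then obtain s where s: "ereal (snd l) < ereal s" "ereal s < g (fst l)"
      using ereal_dense2 by blast
    have "\<forall>\<^sub>F n in sequentially. ereal s < g (fst (p n))"
      using lower_semicontinuous_eventually_nhds[OF assms s(2)] tendsto_fst[OF lim]
      by (rule eventually_compose_filterlim)
    moreover have "\<forall>\<^sub>F n in sequentially. snd (p n) < s"
      using order_tendstoD(2)[OF tendsto_snd[OF lim]] s(1) by simp
    ultimately have "\<forall>\<^sub>F n in sequentially. False"
    proof eventually_elim
      case (elim n)
      have "g (fst (p n)) \<le> ereal (snd (p n))"
        using p by (auto simp: epi_def case_prod_beta)
      with elim show False
        by (metis less_ereal.simps(1) less_le_trans order.asym)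
    qed
    then show False by simp
  qed
qed

lemma slope_nonneg:
  assumes "at x \<noteq> bot"
  shows "0 \<le> slope g x"
proof -
  have "Liminf (at x) (\<lambda>y. max 0 (g x - g y) / ereal (norm (x - y))) \<le> slope g x"
    unfolding slope_def by (rule Liminf_le_Limsup[OF assms])
  moreover have "0 \<le> Liminf (at x) (\<lambda>y. max 0 (g x - g y) / ereal (norm (x - y)))"
    by (intro Liminf_bounded always_eventually allI)
       (auto intro!: zero_le_divide_ereal)
  ultimately show ?thesis by (rule order_trans[rotated])
qed

text \<open>By translation, \<open>x\<close> is isolated only if every point is, and then the limsup defining a slope is
  taken over the trivial filter.\<close>

lemma slope_trivial_space:
  fixes g :: "'a::real_normed_vector \<Rightarrow> ereal"
  assumes "at (x::'a) = bot"
  shows "slope g v = -\<infinity>"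
proof -
  have "open ((+) (v - x) ` {x})"
    using assms by (intro open_translation) (simp add: at_eq_bot_iff)
  then have "at v = bot"
    by (simp add: at_eq_bot_iff)
  then show ?thesis
    by (simp add: slope_def bot_ereal_def)
qed

lemma slope_le_if_locally_linear_lower_bound:
  fixes g :: "'a::real_normed_vector \<Rightarrow> ereal"
  assumes "g v = ereal t" and "0 \<le> c"
    and "\<forall>\<^sub>F y in at v. ereal (t - c * dist y v) \<le> g y"
  shows "slope g v \<le> ereal c"
  unfolding slope_def
proof (rule Limsup_bounded)
  have "\<forall>\<^sub>F y in at v. y \<noteq> v"
    by (simp add: eventually_at_filter)
  with assms(3) show "\<forall>\<^sub>F y in at v. max 0 (g v - g y) / ereal (norm (v - y)) \<le> ereal c"
  proof eventually_elim
    case (elim y)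
    then have pos: "0 < norm (v - y)" by auto
    have "max 0 (g v - g y) \<le> ereal (c * norm (v - y))"
      using elim assms(1,2)
      by (cases "g y") (auto simp: dist_norm norm_minus_commute max_def)
    then have "max 0 (g v - g y) / ereal (norm (v - y))
        \<le> ereal (c * norm (v - y)) / ereal (norm (v - y))"
      using pos by (intro ereal_divide_right_mono) auto
    then show ?case using pos by simp
  qed
qed

lemma slope_less_imp_linear_lower_bound:
  fixes g :: "'a::real_normed_vector \<Rightarrow> ereal"
  assumes "slope g x < ereal c" and "g x = ereal F"
  shows "\<exists>\<rho>>0. \<forall>y. dist y x \<le> \<rho> \<longrightarrow> ereal (F - c * dist y x) \<le> g y"
proof -
  have "\<forall>\<^sub>F y in at x. max 0 (g x - g y) / ereal (norm (x - y)) < ereal c"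
    using assms(1) unfolding slope_def by (rule Limsup_lessD)
  then obtain d where d: "d > 0" and
    *: "\<And>y. y \<noteq> x \<Longrightarrow> dist y x < d \<Longrightarrow> max 0 (g x - g y) / ereal (norm (x - y)) < ereal c"
    unfolding eventually_at by auto
  have "ereal (F - c * dist y x) \<le> g y" if "dist y x \<le> d / 2" for y
  proof (cases "y = x")
    case True
    then show ?thesis using assms(2) by simp
  next
    case False
    then have pos: "0 < norm (x - y)" by simp
    have "max 0 (g x - g y) / ereal (norm (x - y)) < ereal c"
      using * False that d by simp
    then have "max 0 (g x - g y) < ereal (c * norm (x - y))"
      using pos by (simp add: ereal_divide_less_iff mult.commute)
    then show ?thesis
      using assms(2) by (cases "g y") (auto simp: dist_norm norm_minus_commute)
  qed
  with d show ?thesis by (intro exI[of _ "d / 2"]) auto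
qed

section \<open>Ekeland's variational principle\<close>

text \<open>Call \<open>w\<close> below \<open>y\<close> if \<open>g w + e * dist w y \<le> g y\<close>; this is a partial order on \<open>S\<close>, and the
  claim is that some minimal element lies below \<open>z\<close>.  Descend from \<open>z\<close>, coming in each step
  within \<open>(1/2) ^ n\<close> of the infimum of \<open>g\<close> over the elements below.  The values of \<open>g\<close> decrease and
  are bounded below, so the chain is Cauchy, and its limit is below every member of the chain.  Anything
  below the limit can improve the value by at most \<open>(1/2) ^ n\<close>, for every \<open>n\<close>, so it is the limit.

  A real-valued \<open>g\<close> on a set \<open>S\<close> with closed epigraph stands for a lower semicontinuous extended
  function and its effective domain.\<close>

lemma Ekeland_variational_principle:
  fixes g :: "'a::complete_space \<Rightarrow> real"
  assumes cl: "closed {(y, t). y \<in> S \<and> g y \<le> t}"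
    and lb: "\<And>y. y \<in> S \<Longrightarrow> b \<le> g y"
    and z: "z \<in> S" and e: "0 < e"
  obtains v where "v \<in> S" and "g v + e * dist v z \<le> g z"
    and "\<And>y. y \<in> S \<Longrightarrow> y \<noteq> v \<Longrightarrow> g v < g y + e * dist y v"
proof -
  define T where "T = (\<lambda>y. {w \<in> S. g w + e * dist w y \<le> g y})"
  have T_self: "y \<in> T y" if "y \<in> S" for y
    using that by (simp add: T_def)
  have T_sub: "T y \<subseteq> S" for y
    by (auto simp: T_def)
  have T_trans: "w \<in> T u" if "w \<in> T y" "y \<in> T u" for w y u
  proof -
    have "e * dist w u \<le> e * (dist w y + dist y u)"
      using e by (intro mult_left_mono dist_triangle) auto
    with that show ?thesis by (auto simp: T_def algebra_simps)
  qed
  have bdd: "bdd_below (g ` T y)" for y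
    using lb T_sub by (intro bdd_belowI2[of _ b]) blast
  have step: "\<exists>w. w \<in> T y \<and> g w < Inf (g ` T y) + (1/2) ^ n" if "y \<in> S" for y and n :: nat
  proof -
    have "\<exists>w\<in>T y. g w < Inf (g ` T y) + (1/2) ^ n"
      using cInf_lessD[of "g ` T y" "Inf (g ` T y) + (1/2) ^ n"] T_self[OF that] by auto
    then show ?thesis by blast
  qed
  have "\<exists>s. \<forall>n. (s n \<in> S \<and> (n = 0 \<longrightarrow> s n = z)) \<and>
      (s (Suc n) \<in> T (s n) \<and> g (s (Suc n)) < Inf (g ` T (s n)) + (1/2) ^ n)"
  proof (rule dependent_nat_choice)
    show "\<exists>s. s \<in> S \<and> (0 = (0::nat) \<longrightarrow> s = z)" using z by blast
  next
    fix y and n :: nat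
    assume "y \<in> S \<and> (n = 0 \<longrightarrow> y = z)"
    then show "\<exists>w. (w \<in> S \<and> (Suc n = 0 \<longrightarrow> w = z)) \<and> w \<in> T y \<and> g w < Inf (g ` T y) + (1/2) ^ n"
      using step[of y n] T_sub by blast
  qed
  then obtain s where s0: "s 0 = z" and sS: "\<And>n. s n \<in> S"
    and sT: "\<And>n. s (Suc n) \<in> T (s n)"
    and sInf: "\<And>n. g (s (Suc n)) < Inf (g ` T (s n)) + (1/2) ^ n"
    by blast
  have chain: "s m \<in> T (s n)" if "n \<le> m" for n m
    using that by (induction rule: dec_induct) (use T_self sS sT T_trans in blast)+
  have chain': "g (s m) + e * dist (s m) (s n) \<le> g (s n)" if "n \<le> m" for n m
    using chain[OF that] by (simp add: T_def)
  have "decseq (\<lambda>n. g (s n))"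
    unfolding decseq_def
  proof (intro allI impI)
    fix m n :: nat
    assume "m \<le> n"
    then show "g (s n) \<le> g (s m)"
      using chain'[of m n] e zero_le_dist[of "s n" "s m"]
      by (smt (verit) mult_nonneg_nonneg)
  qed
  then obtain L where L: "(\<lambda>n. g (s n)) \<longlonglongrightarrow> L" and Lle: "\<And>n. L \<le> g (s n)"
    using decseq_convergent[of "\<lambda>n. g (s n)" b] lb sS by blast
  have "Cauchy s"
    unfolding Cauchy_altdef
  proof (intro allI impI)
    fix r :: real
    assume r: "r > 0"
    have "\<forall>\<^sub>F n in sequentially. g (s n) < L + e * r"
      using order_tendstoD(2)[OF L] e r by simp
    then obtain M where M: "\<And>n. n \<ge> M \<Longrightarrow> g (s n) < L + e * r"
      unfolding eventually_sequentially by blast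
    have "dist (s m) (s n) < r" if "m \<ge> M" "n > m" for m n
    proof -
      have "e * dist (s n) (s m) < e * r"
        using chain'[of m n] M[of m] Lle[of n] that by simp
      then show ?thesis using e by (simp add: dist_commute)
    qed
    then show "\<exists>M. \<forall>m\<ge>M. \<forall>n>m. dist (s m) (s n) < r" by blast
  qed
  then obtain v where v: "s \<longlonglongrightarrow> v"
    using Cauchy_convergent convergent_def by blast
  have "(v, L) \<in> {(y, t). y \<in> S \<and> g y \<le> t}"
    using closed_sequentially[OF cl, of "\<lambda>n. (s n, g (s n))"] sS tendsto_Pair[OF v L] by auto
  then have vS: "v \<in> S" and gv: "g v \<le> L" by auto
  \<comment> \<open>Comparing with the limit \<open>L\<close> of the values rather than with \<open>g v\<close> lets the inequality pass
    to the limit, since \<open>g\<close> is only semicontinuous.\<close>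
  have vT: "v \<in> T (s n)" for n
  proof -
    have "L + e * dist v (s n) \<le> g (s n)"
    proof (rule LIMSEQ_le_const2)
      show "(\<lambda>m. g (s m) + e * dist (s m) (s n)) \<longlonglongrightarrow> L + e * dist v (s n)"
        by (intro tendsto_intros L v)
      show "\<exists>N. \<forall>m\<ge>N. g (s m) + e * dist (s m) (s n) \<le> g (s n)"
        using chain' by blast
    qed
    with gv vS show ?thesis by (simp add: T_def)
  qed
  show thesis
  proof (rule that[OF vS])
    show "g v + e * dist v z \<le> g z"
      using vT[of 0] s0 by (simp add: T_def)
  next
    fix y
    assume y: "y \<in> S" "y \<noteq> v"
    show "g v < g y + e * dist y v"
    proof (rule ccontr)
      assume "\<not> g v < g y + e * dist y v"
      with y have yv: "y \<in> T v" by (simp add: T_def)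
      have "e * dist y v \<le> (1/2) ^ n" for n
      proof -
        have "Inf (g ` T (s n)) \<le> g y"
          using T_trans[OF yv vT] bdd by (intro cInf_lower) auto
        with yv sInf[of n] gv Lle[of "Suc n"] show ?thesis by (simp add: T_def)
      qed
      then have "e * dist y v \<le> 0"
        by (intro LIMSEQ_le_const[OF LIMSEQ_realpow_zero[of "1/2"]]) auto
      moreover have "0 < e * dist y v" using e y by simp
      ultimately show False by simp
    qed
  qed
qed

section \<open>Lower bounds inherited along Wijsman convergence\<close>

text \<open>A point of the epigraph that is closer than \<open>\<eta>\<close> to the disc horizontally lies over the enlarged
  ball, so its height exceeds \<open>\<alpha>\<close> by at least \<open>\<eta>\<close>: the max norm sees one of the two.\<close>

lemma gap_ge_if_bounded_below:
  fixes g :: "'a::real_normed_vector \<Rightarrow> ereal"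
  assumes "\<And>y. dist y x \<le> l + \<eta> \<Longrightarrow> ereal (\<alpha> + \<eta>) \<le> g y"
  shows "ereal \<eta> \<le> gap max_norm (cball x l \<times> {\<alpha>}) (epi g)"
  unfolding gap_def
proof (intro INF_greatest)
  fix a b :: "'a \<times> real"
  assume a: "a \<in> cball x l \<times> {\<alpha>}" and b: "b \<in> epi g"
  have gb: "g (fst b) \<le> ereal (snd b)"
    using b by (auto simp: epi_def)
  show "ereal \<eta> \<le> ereal (max_norm (a - b))"
  proof (cases "norm (fst a - fst b) < \<eta>")
    case True
    have "dist (fst b) x \<le> dist (fst a) (fst b) + dist (fst a) x"
      by (rule dist_triangle3)
    also have "\<dots> \<le> l + \<eta>"
      using a True by (auto simp: dist_norm norm_minus_commute)
    finally have "ereal (\<alpha> + \<eta>) \<le> ereal (snd b)"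
      using assms gb by (meson order_trans)
    then have "\<eta> \<le> \<bar>snd (a - b)\<bar>"
      using a by auto
    then show ?thesis
      by (simp add: max_norm_def le_max_iff_disj)
  qed (simp add: max_norm_def le_max_iff_disj)
qed

lemma bounded_below_if_gap_pos:
  fixes g :: "'a::real_normed_vector \<Rightarrow> ereal"
  assumes "0 < gap max_norm (cball x l \<times> {\<alpha>}) (epi g)" and "dist y x \<le> l"
  shows "ereal \<alpha> < g y"
proof (rule ccontr)
  assume "\<not> ereal \<alpha> < g y"
  then have "(y, \<alpha>) \<in> epi g" by (simp add: epi_def)
  moreover have "(y, \<alpha>) \<in> cball x l \<times> {\<alpha>}" using assms(2) by (simp add: dist_commute)
  ultimately
  have "gap max_norm (cball x l \<times> {\<alpha>}) (epi g)
      \<le> ereal (max_norm ((y, \<alpha>) - (y, \<alpha>)))"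
    unfolding gap_def by (blast intro: INF_lower2 INF_lower)
  with assms(1) show False by (simp add: max_norm_def zero_ereal_def)
qed

lemma wijsman_eventually_bounded_below:
  fixes f :: "'a::real_normed_vector \<Rightarrow> ereal"
  assumes W: "wijsman_convergent_at_radius fn f x r"
    and l: "0 \<le> l" "ereal l < r" and \<eta>: "0 < \<eta>"
    and lb: "\<And>y. dist y x \<le> l + \<eta> \<Longrightarrow> ereal (\<alpha> + \<eta>) \<le> f y"
  shows "\<forall>\<^sub>F n in sequentially. \<forall>y. dist y x \<le> l \<longrightarrow> ereal \<alpha> < fn n y"
proof -
  have "0 < gap max_norm (cball x l \<times> {\<alpha>}) (epi f)"
    using less_le_trans[OF _ gap_ge_if_bounded_below[of x l \<eta> \<alpha> f]] lb \<eta> by simp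
  then have "0 < (SUP \<delta>\<in>{0<..}.
      liminf (\<lambda>n. gap max_norm (cball x (l + \<delta>) \<times> {\<alpha>}) (epi (fn n))))"
    using W l unfolding wijsman_convergent_at_radius_def by blast
  then obtain \<delta> where \<delta>: "0 < \<delta>"
    "0 < liminf (\<lambda>n. gap max_norm (cball x (l + \<delta>) \<times> {\<alpha>}) (epi (fn n)))"
    unfolding less_SUP_iff by auto
  have "\<forall>\<^sub>F n in sequentially. 0 < gap max_norm (cball x (l + \<delta>) \<times> {\<alpha>}) (epi (fn n))"
    by (rule less_LiminfD[OF \<delta>(2)])
  then show ?thesis
  proof eventually_elim
    case (elim n)
    then show ?case
      using bounded_below_if_gap_pos[OF elim] \<delta>(1) by (simp add: add_increasing2)
  qed
qed

text \<open>On \<open>cball x l\<close> the cone is at least \<open>F - c * l\<close>, a constant bound that passes to \<open>fn n\<close>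
  for large \<open>n\<close>, but how large depends on \<open>l\<close>.  Only a finite grid of radii is therefore used; a point
  \<open>y\<close> is treated with the least radius of the grid that reaches it, which overestimates
  \<open>dist y x\<close> by no more than the mesh.\<close>

lemma wijsman_eventually_linear_lower_bound:
  fixes f :: "'a::real_normed_vector \<Rightarrow> ereal"
  assumes W: "wijsman_convergent_at_radius fn f x r"
    and c: "0 \<le> c" and \<sigma>: "\<sigma> < \<rho>" "ereal \<rho> \<le> r" and h: "0 < h"
    and lb: "\<And>y. dist y x \<le> \<rho> \<Longrightarrow> ereal (F - c * dist y x) \<le> f y"
  shows "\<forall>\<^sub>F n in sequentially. \<forall>y. dist y x \<le> \<sigma> \<longrightarrow> ereal (F - c * dist y x - h) \<le> fn n y"
proof -
  \<comment> \<open>The mesh \<open>s\<close> of the grid of radii costs at most \<open>c * s \<le> h / 2\<close> in height; the other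
    \<open>h / 2\<close> makes the gap positive.\<close>
  have half: "(c + 1) * (h / (2 * (c + 1))) = h / 2"
    using c by (simp add: field_simps)
  define s where "s = min ((\<rho> - \<sigma>) / 2) (h / (2 * (c + 1)))"
  have s: "0 < s" "s < \<rho> - \<sigma>"
    using \<sigma> h c by (auto simp: s_def intro: min.strict_coboundedI1)
  have "c * s \<le> (c + 1) * (h / (2 * (c + 1)))"
    using c s(1) by (intro mult_mono) (auto simp: s_def)
  then have cs: "c * s \<le> h / 2"
    unfolding half .
  define N where "N = {i::nat. real i * s < \<rho>}"
  have "N \<subseteq> {..nat \<lceil>\<rho> / s\<rceil>}"
  proof
    fix i
    assume "i \<in> N"
    then have "real i < \<rho> / s" using s by (simp add: N_def field_simps)
    then show "i \<in> {..nat \<lceil>\<rho> / s\<rceil>}" by simp linarith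
  qed
  then have "finite N" by (rule finite_subset) simp
  moreover have "\<forall>\<^sub>F n in sequentially. \<forall>y. dist y x \<le> real i * s \<longrightarrow>
      ereal (F - c * (real i * s) - h / 2) < fn n y" if i: "i \<in> N" for i
  proof -
    define l where "l = real i * s"
    define \<eta> where "\<eta> = min (\<rho> - l) (h / (2 * (c + 1)))"
    have l: "0 \<le> l" "l < \<rho>" using i s by (auto simp: l_def N_def)
    have \<eta>: "0 < \<eta>" using l h c by (auto simp: \<eta>_def)
    have "(c + 1) * \<eta> \<le> (c + 1) * (h / (2 * (c + 1)))"
      using c by (intro mult_left_mono) (auto simp: \<eta>_def)
    then have c\<eta>: "(c + 1) * \<eta> \<le> h / 2"
      unfolding half .
    have "ereal (F - c * l - h / 2 + \<eta>) \<le> f y" if "dist y x \<le> l + \<eta>" for y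
    proof -
      have "c * dist y x \<le> c * (l + \<eta>)" using that c by (intro mult_left_mono) auto
      with c\<eta> have "F - c * l - h / 2 + \<eta> \<le> F - c * dist y x" by (simp add: algebra_simps)
      moreover have "dist y x \<le> \<rho>" using that by (simp add: \<eta>_def)
      ultimately show ?thesis using lb by (meson ereal_less_eq(3) order_trans)
    qed
    moreover have "ereal l < r" using l \<sigma> by (meson less_ereal.simps(1) less_le_trans)
    ultimately show ?thesis
      using wijsman_eventually_bounded_below[OF W l(1) _ \<eta>] by (simp add: l_def)
  qed
  ultimately have "\<forall>\<^sub>F n in sequentially. \<forall>i\<in>N. \<forall>y. dist y x \<le> real i * s \<longrightarrow>
      ereal (F - c * (real i * s) - h / 2) < fn n y"
    by (intro eventually_ball_finite) blast+
  then show ?thesis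
  proof eventually_elim
    case (elim n)
    show ?case
    proof (intro allI impI)
      fix y
      assume y: "dist y x \<le> \<sigma>"
      define i where "i = nat \<lceil>dist y x / s\<rceil>"
      have "dist y x / s \<le> real i" "real i < dist y x / s + 1"
        using s ceiling_correct[of "dist y x / s"] by (auto simp: i_def)
      then have i: "dist y x \<le> real i * s" "real i * s \<le> dist y x + s"
        using s by (auto simp: field_simps)
      with y s have "i \<in> N" by (simp add: N_def)
      with elim i have "ereal (F - c * (real i * s) - h / 2) < fn n y" by blast
      moreover have "c * (real i * s) \<le> c * dist y x + c * s"
        using mult_left_mono[OF i(2) c] by (simp add: algebra_simps)
      with cs have "F - c * dist y x - h \<le> F - c * (real i * s) - h / 2" by simp
      ultimately show "ereal (F - c * dist y x - h) \<le> fn n y"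
        by (meson ereal_less_eq(3) less_imp_le order_trans)
    qed
  qed
qed

section \<open>Approximating points of small slope\<close>

text \<open>Ekeland's principle is applied to \<open>g + c * dist _ x\<close> on the ball.  The hypothesis on \<open>z\<close> says that
  \<open>z\<close> is so close to minimal that the displacement from \<open>z\<close>, which is at most the defect divided by
  \<open>e\<close>, cannot reach the boundary; at an interior point the
  minimality over the ball is a local statement and controls the slope.\<close>

lemma Ekeland_point_of_small_slope:
  fixes g :: "'a::banach \<Rightarrow> ereal"
  assumes lsc: "lower_semicontinuous g"
    and c: "0 \<le> c" and e: "0 < e"
    and lb: "\<And>y. dist y x \<le> \<sigma> \<Longrightarrow> ereal (b - c * dist y x) \<le> g y"
    and gz: "g z = ereal tz" and zx: "dist z x \<le> \<sigma>"
    and z: "tz + c * dist z x - b < e * (\<sigma> - dist z x)"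
  obtains v t where "g v = ereal t" and "dist v x < \<sigma>"
    and "t + c * dist v x + e * dist v z \<le> tz + c * dist z x"
    and "slope g v \<le> ereal (c + e)"
proof -
  define S where "S = {y. dist y x \<le> \<sigma> \<and> g y < \<infinity>}"
  define \<phi> where "\<phi> = (\<lambda>y. real_of_ereal (g y) + c * dist y x)"
  have fin: "g y = ereal (real_of_ereal (g y))" if "y \<in> S" for y
    using that lb[of y] by (cases "g y") (auto simp: S_def)
  have \<phi>_lb: "b \<le> \<phi> y" if "y \<in> S" for y
    using lb[of y] fin[OF that] that unfolding S_def \<phi>_def
    by (metis (no_types, lifting) ereal_less_eq(3) diff_le_eq mem_Collect_eq)
  have "p \<in> {(y, t). y \<in> S \<and> \<phi> y \<le> t} \<longleftrightarrow>
      p \<in> (cball x \<sigma> \<times> UNIV) \<inter> (\<lambda>p. (fst p, snd p - c * dist (fst p) x)) -` epi g" for p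
    using lb[of "fst p"]
    by (cases "g (fst p)") (auto simp: S_def \<phi>_def epi_def dist_commute case_prod_beta mem_Times_iff)
  then have "{(y, t). y \<in> S \<and> \<phi> y \<le> t}
      = (cball x \<sigma> \<times> UNIV) \<inter> (\<lambda>p. (fst p, snd p - c * dist (fst p) x)) -` epi g"
    by blast
  moreover have "closed ((cball x \<sigma> \<times> UNIV) \<inter> (\<lambda>p. (fst p, snd p - c * dist (fst p) x)) -` epi g)"
    by (intro closed_Int closed_Times closed_vimage closed_epi[OF lsc] continuous_intros) auto
  ultimately have cl: "closed {(y, t). y \<in> S \<and> \<phi> y \<le> t}" by simp
  have zS: "z \<in> S" using zx gz by (simp add: S_def)
  obtain v where vS: "v \<in> S" and vz: "\<phi> v + e * dist v z \<le> \<phi> z"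
    and min: "\<And>y. y \<in> S \<Longrightarrow> y \<noteq> v \<Longrightarrow> \<phi> v < \<phi> y + e * dist y v"
    using Ekeland_variational_principle[OF cl \<phi>_lb zS e] by blast
  define t where "t = real_of_ereal (g v)"
  have t: "g v = ereal t" using fin[OF vS] by (simp add: t_def)
  have vz': "t + c * dist v x + e * dist v z \<le> tz + c * dist z x"
    using vz gz by (simp add: \<phi>_def t_def)
  have "e * dist v z \<le> tz + c * dist z x - b"
    using vz' \<phi>_lb[OF vS] by (simp add: \<phi>_def t_def)
  with z have "e * dist v z < e * (\<sigma> - dist z x)" by simp
  then have "dist v z < \<sigma> - dist z x" using e by simp
  with dist_triangle[of v x z] have vx: "dist v x < \<sigma>" by simp
  have "\<forall>\<^sub>F y in at v. y \<in> ball x \<sigma>"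
    by (intro eventually_at_in_open' open_ball) (use vx in \<open>simp add: dist_commute\<close>)
  then have "\<forall>\<^sub>F y in at v. ereal (t - (c + e) * dist y v) \<le> g y"
  proof eventually_elim
    case (elim y)
    show ?case
    proof (cases "y \<in> S \<and> y \<noteq> v")
      case True
      have "c * dist y x \<le> c * (dist y v + dist v x)"
        using c by (intro mult_left_mono dist_triangle) auto
      then have "t - (c + e) * dist y v \<le> real_of_ereal (g y)"
        using min[of y] True by (simp add: \<phi>_def t_def algebra_simps)
      then show ?thesis using fin[of y] True by (metis ereal_less_eq(3))
    next
      case False
      then show ?thesis using elim t by (auto simp: S_def dist_commute)
    qed
  qed
  then have "slope g v \<le> ereal (c + e)"
    using t c e by (intro slope_le_if_locally_linear_lower_bound) auto
  with t vx vz' show thesis by (rule that)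
qed

text \<open>Some \<open>c'\<close> strictly between the slope of \<open>f\<close> and \<open>c\<close> splits the room below \<open>c\<close>: the cone of
  rate \<open>c'\<close> bounds \<open>f\<close> near \<open>x\<close>, and \<open>e = c - c'\<close> is left for Ekeland's principle.\<close>

lemma wijsman_eventually_point_of_small_slope:
  fixes f :: "'a::banach \<Rightarrow> ereal"
  assumes lsc: "\<And>n. lower_semicontinuous (fn n)"
    and W: "wijsman_convergent_at_radius fn f x r" and r: "0 < r"
    and F: "f x = ereal F" and c: "0 < c" "slope f x < ereal c" and \<epsilon>: "0 < \<epsilon>"
  shows "\<forall>\<^sub>F n in sequentially. \<exists>v t. dist v x < \<epsilon> \<and> fn n v = ereal t \<and> \<bar>t - F\<bar> < \<epsilon> \<and>
    slope (fn n) v \<le> ereal c"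
proof -
  have "max 0 (slope f x) < ereal c" using c by simp
  then obtain c' where "max 0 (slope f x) < ereal c'" and "ereal c' < ereal c"
    using ereal_dense2 by blast
  then have c'c: "c' < c" by simp
  from \<open>max 0 (slope f x) < ereal c'\<close> have c': "0 \<le> c'" "slope f x < ereal c'" by auto
  define e where "e = c - c'"
  have e: "0 < e" using c'c by (simp add: e_def)
  obtain \<rho>0 where \<rho>0: "0 < \<rho>0" "\<And>y. dist y x \<le> \<rho>0 \<Longrightarrow> ereal (F - c' * dist y x) \<le> f y"
    using slope_less_imp_linear_lower_bound[OF c'(2) F] by blast
  obtain r' where r': "0 < r'" "ereal r' < r"
    using ereal_dense2[OF r] by auto
  define \<rho> where "\<rho> = min \<rho>0 r'"
  have \<rho>: "0 < \<rho>" "ereal \<rho> \<le> r"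
    using \<rho>0(1) r' by (auto simp: \<rho>_def min_def intro: order_trans[of _ "ereal r'"])
  \<comment> \<open>The radius \<open>\<sigma>\<close> keeps \<open>v\<close> near \<open>x\<close> and the drop \<open>c' * \<sigma>\<close> of the cone below \<open>\<epsilon> / 2\<close>.\<close>
  define \<sigma> where "\<sigma> = min (\<rho> / 2) (\<epsilon> / (2 * (c' + 1)))"
  have \<sigma>: "0 < \<sigma>" "\<sigma> < \<rho>"
    using \<rho>(1) \<epsilon> c'(1) by (auto simp: \<sigma>_def intro: min.strict_coboundedI1)
  have "\<sigma> * (2 * (c' + 1)) \<le> \<epsilon>"
    using c'(1) pos_le_divide_eq[of "2 * (c' + 1)" \<sigma> \<epsilon>] by (simp add: \<sigma>_def)
  then have \<sigma>\<epsilon>: "2 * \<sigma> + 2 * (c' * \<sigma>) \<le> \<epsilon>"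
    by (simp add: algebra_simps)
  \<comment> \<open>The recovery point \<open>z\<close> has defect less than \<open>2 * h + c' * h\<close> and \<open>dist z x < h\<close>, so
    the first bound on \<open>h\<close> makes the defect less than \<open>e * (\<sigma> - dist z x)\<close>; the second bound keeps
    the value at \<open>v\<close> within \<open>\<epsilon>\<close> of \<open>F\<close>.\<close>
  define h where "h = min (e * \<sigma> / (2 + c' + e)) (\<epsilon> / (3 * (c' + 1)))"
  have h: "0 < h" using e \<sigma>(1) c'(1) \<epsilon> by (simp add: h_def)
  have "h * (2 + c' + e) \<le> e * \<sigma>" "h * (3 * (c' + 1)) \<le> \<epsilon>"
    using c'(1) e pos_le_divide_eq[of "2 + c' + e" h "e * \<sigma>"]
      pos_le_divide_eq[of "3 * (c' + 1)" h \<epsilon>]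
    by (simp_all add: h_def)
  then have h\<sigma>: "2 * h + c' * h + e * h \<le> e * \<sigma>" and h\<epsilon>: "3 * h + 3 * (c' * h) \<le> \<epsilon>"
    by (simp_all add: algebra_simps)
  have c'h: "0 \<le> c' * h" and c'\<sigma>: "0 \<le> c' * \<sigma>" using c'(1) h \<sigma>(1) by simp_all
  have "e * h < e * \<sigma>" using h\<sigma> h c'h by linarith
  then have "h < \<sigma>" using e by simp
  obtain zs where zs: "zs \<longlonglongrightarrow> x" "(\<lambda>n. fn n (zs n)) \<longlonglongrightarrow> f x"
    using W r unfolding wijsman_convergent_at_radius_def
    by (metis order_refl zero_ereal_def)
  have "\<forall>\<^sub>F n in sequentially. dist (zs n) x < h"
    using tendstoD[OF zs(1) h] .
  moreover have "\<forall>\<^sub>F n in sequentially. fn n (zs n) < ereal (F + h)"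
    using order_tendstoD(2)[OF zs(2)] F h by simp
  moreover have "\<forall>\<^sub>F n in sequentially. \<forall>y. dist y x \<le> \<sigma> \<longrightarrow> ereal (F - c' * dist y x - h) \<le> fn n y"
    using wijsman_eventually_linear_lower_bound[OF W c'(1) \<sigma>(2) \<rho>(2) h] \<rho>0(2)
    by (simp add: \<rho>_def)
  ultimately show ?thesis
  proof eventually_elim
    case (elim n)
    define z where "z = zs n"
    have zh: "dist z x < h" and fz: "fn n z < ereal (F + h)" using elim by (simp_all add: z_def)
    have lb: "ereal (F - h - c' * dist y x) \<le> fn n y" if "dist y x \<le> \<sigma>" for y
      using elim that by (simp add: algebra_simps)
    have z\<sigma>: "dist z x \<le> \<sigma>" using zh \<open>h < \<sigma>\<close> by simp
    obtain tz where tz: "fn n z = ereal tz"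
      using lb[OF z\<sigma>] fz by (cases "fn n z") auto
    have tzF: "tz < F + h" using fz tz by simp
    have c'z: "c' * dist z x \<le> c' * h" and ez: "e * dist z x \<le> e * h"
      using zh c'(1) e by (intro mult_left_mono; simp)+
    have "tz + c' * dist z x - (F - h) < e * (\<sigma> - dist z x)"
      unfolding right_diff_distrib using tzF c'z ez h\<sigma> by linarith
    then obtain v t where t: "fn n v = ereal t" and v: "dist v x < \<sigma>"
      and le: "t + c' * dist v x + e * dist v z \<le> tz + c' * dist z x"
      and slope: "slope (fn n) v \<le> ereal (c' + e)"
      using Ekeland_point_of_small_slope[OF lsc[of n] c'(1) e lb tz z\<sigma>] by blast
    have "t \<le> tz + c' * dist z x"
      using le mult_nonneg_nonneg[OF c'(1) zero_le_dist[of v x]]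
        mult_nonneg_nonneg[OF less_imp_le[OF e] zero_le_dist[of v z]] by linarith
    then have "t < F + \<epsilon>" using tzF c'z h\<epsilon> h c'h by linarith
    moreover have "F - \<epsilon> < t"
    proof -
      have "c' * dist v x \<le> c' * \<sigma>" using v c'(1) by (intro mult_left_mono) simp_all
      moreover have "F - h - c' * dist v x \<le> t" using lb[of v] v t by simp
      ultimately show ?thesis using \<sigma>\<epsilon> h\<epsilon> h c'h \<sigma>(1) by linarith
    qed
    moreover have "dist v x < \<epsilon>" using v \<sigma>\<epsilon> \<sigma>(1) c'\<sigma> by linarith
    ultimately show ?case using t slope by (auto simp: e_def abs_less_iff)
  qed
qed

text \<open>At index \<open>n\<close>, satisfy the strongest property \<open>Q k n\<close> with \<open>k \<le> n\<close> that can be satisfied.\<close>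

lemma eventually_diagonal:
  fixes Q :: "nat \<Rightarrow> nat \<Rightarrow> 'b \<Rightarrow> bool"
  assumes ev: "\<And>k. \<forall>\<^sub>F n in sequentially. \<exists>v. Q k n v"
    and anti: "\<And>j k n v. Q k n v \<Longrightarrow> j \<le> k \<Longrightarrow> Q j n v"
  shows "\<exists>s. \<forall>k. \<forall>\<^sub>F n in sequentially. Q k n (s n)"
proof -
  define A where "A = (\<lambda>n. {k. k \<le> n \<and> (\<exists>v. Q k n v)})"
  define s where "s = (\<lambda>n. SOME v. Q (Max (A n)) n v)"
  have fin: "finite (A n)" for n by (simp add: A_def)
  have "\<forall>\<^sub>F n in sequentially. Q k n (s n)" for k
    using ev[of k] eventually_ge_at_top[of k]
  proof eventually_elim
    case (elim n)
    then have k: "k \<in> A n" by (simp add: A_def)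
    then have "Max (A n) \<in> A n" using Max_in[OF fin] by blast
    then have "\<exists>v. Q (Max (A n)) n v" by (simp add: A_def)
    then have "Q (Max (A n)) n (s n)" unfolding s_def by (rule someI_ex)
    then show ?case using anti Max_ge[OF fin k] by blast
  qed
  then show ?thesis by blast
qed

theorem theorem5p1:
  fixes fn :: "nat \<Rightarrow> 'a::banach \<Rightarrow> ereal" and f :: "'a \<Rightarrow> ereal" and x :: 'a
  assumes "\<And>n y. fn n y \<noteq> -\<infinity>" and "\<And>y. f y \<noteq> -\<infinity>"
    and "\<And>n. lower_semicontinuous (fn n)" and "lower_semicontinuous f"
    and "x \<in> effective_domain f"
    and "wijsman_convergent_at fn f x"
  shows "\<exists>xs. xs \<longlonglongrightarrow> x \<and> (\<lambda>n. fn n (xs n)) \<longlonglongrightarrow> f x \<and>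
           limsup (\<lambda>n. slope (fn n) (xs n)) \<le> slope f x"
proof -
  obtain r where r: "0 < r" and W: "wijsman_convergent_at_radius fn f x r"
    using assms(6) unfolding wijsman_convergent_at_def by blast
  obtain zs where zs: "zs \<longlonglongrightarrow> x" "(\<lambda>n. fn n (zs n)) \<longlonglongrightarrow> f x"
    using W r unfolding wijsman_convergent_at_radius_def
    by (metis order_refl zero_ereal_def)
  obtain F where F: "f x = ereal F"
    using assms(2)[of x] assms(5) by (cases "f x") (auto simp: effective_domain_def)
  consider "at x = bot" | "slope f x = \<infinity>" | "at x \<noteq> bot" "slope f x \<noteq> \<infinity>" by blast
  then show ?thesis
  proof cases
    case 1
    then have "slope f x = -\<infinity>" "\<And>n. slope (fn n) (zs n) = -\<infinity>"
      by (rule slope_trivial_space)+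
    with zs show ?thesis by (intro exI[of _ zs]) (simp add: Limsup_const)
  next
    case 2
    with zs show ?thesis by (intro exI[of _ zs]) simp
  next
    case 3
    then obtain m where m: "slope f x = ereal m" "0 \<le> m"
      using slope_nonneg[OF 3(1), of f] by (cases "slope f x") auto
    define \<epsilon> where "\<epsilon> = (\<lambda>k. 1 / real (Suc k))"
    have \<epsilon>_pos: "0 < \<epsilon> k" for k by (simp add: \<epsilon>_def)
    have \<epsilon>_mono: "\<epsilon> k \<le> \<epsilon> j" if "j \<le> k" for j k
      using that by (simp add: \<epsilon>_def frac_le)
    have \<epsilon>_small: "\<exists>k. \<epsilon> k < d" if "0 < d" for d
      using nat_approx_posE[OF that] unfolding \<epsilon>_def by metis
    define Q where "Q = (\<lambda>k n v. \<exists>t. dist v x < \<epsilon> k \<and> fn n v = ereal t \<and> \<bar>t - F\<bar> < \<epsilon> k \<and>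
      slope (fn n) v \<le> ereal (m + \<epsilon> k))"
    have "\<exists>s. \<forall>k. \<forall>\<^sub>F n in sequentially. Q k n (s n)"
    proof (rule eventually_diagonal)
      show "\<forall>\<^sub>F n in sequentially. \<exists>v. Q k n v" for k
        using wijsman_eventually_point_of_small_slope[OF assms(3) W r F, of "m + \<epsilon> k" "\<epsilon> k"]
          m \<epsilon>_pos[of k] by (simp add: Q_def)
    next
      fix j k n v
      assume "Q k n v" "j \<le> k"
      then show "Q j n v"
        using \<epsilon>_mono[of j k] unfolding Q_def
        by (meson add_left_mono ereal_less_eq(3) less_le_trans order_trans)
    qed
    then obtain s where s: "\<And>k. \<forall>\<^sub>F n in sequentially. Q k n (s n)" by blast
    have "s \<longlonglongrightarrow> x"
    proof (rule tendstoI)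
      fix d :: real
      assume "0 < d"
      then obtain k where "\<epsilon> k < d" using \<epsilon>_small by blast
      with s[of k] show "\<forall>\<^sub>F n in sequentially. dist (s n) x < d"
        by (auto simp: Q_def elim!: eventually_mono)
    qed
    moreover have "(\<lambda>n. fn n (s n)) \<longlonglongrightarrow> f x"
    proof -
      have "(\<lambda>n. real_of_ereal (fn n (s n))) \<longlonglongrightarrow> F"
      proof (rule tendstoI)
        fix d :: real
        assume "0 < d"
        then obtain k where "\<epsilon> k < d" using \<epsilon>_small by blast
        with s[of k] show "\<forall>\<^sub>F n in sequentially. dist (real_of_ereal (fn n (s n))) F < d"
          by (auto simp: Q_def dist_real_def elim!: eventually_mono)
      qed
      then have "(\<lambda>n. ereal (real_of_ereal (fn n (s n)))) \<longlonglongrightarrow> f x"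
        unfolding F by (rule tendsto_ereal)
      moreover have "\<forall>\<^sub>F n in sequentially. ereal (real_of_ereal (fn n (s n))) = fn n (s n)"
        using s[of 0] by (auto simp: Q_def elim!: eventually_mono)
      ultimately show ?thesis by (rule Lim_transform_eventually)
    qed
    moreover have "limsup (\<lambda>n. slope (fn n) (s n)) \<le> slope f x"
    proof (rule ereal_le_epsilon2)
      fix d :: real
      assume "0 < d"
      then obtain k where k: "\<epsilon> k < d" using \<epsilon>_small by blast
      have "limsup (\<lambda>n. slope (fn n) (s n)) \<le> ereal (m + \<epsilon> k)"
        using s[of k] by (intro Limsup_bounded) (auto simp: Q_def elim!: eventually_mono)
      also have "\<dots> \<le> slope f x + ereal d" using k m by simp
      finally show "limsup (\<lambda>n. slope (fn n) (s n)) \<le> slope f x + ereal d" .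
    qed
    ultimately show ?thesis by blast
  qed
qed

end
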